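(* Let $p$ be analytic in $\mathbb{D}$ with $p(0)=1$ and $p\in\mathcal{H}[1,2]$. If $$p^2(z)+zp'(z)+z^2p''(z)\prec 1+\left(1+\frac{3}{2\sqrt{2}}\right)z,$$ then $p(z)\prec\sqrt{1+z}$.
   Context: $\mathbb{D}=\{z\in\mathbb{C}:|z|<1\}$; $p^k(z)=(p(z))^k$. $\mathcal{H}[1,2]$ is the set of analytic functions on $\mathbb{D}$ with Taylor expansion $1+a_2z^2+a_3z^3+\cdots$. For analytic $f,g$ on $\mathbb{D}$, $f\prec g$ ($f$ is subordinate to $g$) means there is an analytic $w:\mathbb{D}\to\mathbb{D}$ with $w(0)=0$ and $f(z)=g(w(z))$ for all $z\in\mathbb{D}$. $\sqrt{1+z}$ is the principal branch; it maps $\mathbb{D}$ univalently onto $\{w:|w^2-1|<1,\ \operatorname{Re}w>0\}$. *)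

theory Defs
  imports "HOL-Complex_Analysis.Complex_Analysis"
begin

abbreviation unit_disc :: "complex set" where
  "unit_disc \<equiv> ball 0 1"

text \<open>The class of analytic functions on the unit disc with Taylor expansion
  \<open>a + c\<^sub>n z\<^sup>n + c\<^sub>n\<^sub>+\<^sub>1 z\<^sup>n\<^sup>+\<^sup>1 + \<dots>\<close>; the sequence \<open>c\<close> below is shifted by \<open>n\<close>.\<close>

definition H_class :: "complex \<Rightarrow> nat \<Rightarrow> (complex \<Rightarrow> complex) set" where
  "H_class a n = {f. f analytic_on unit_disc \<and>
     (\<exists>c. \<forall>z\<in>unit_disc. (\<lambda>k. c k * z ^ (k + n)) sums (f z - a))}"

text \<open>Functions on the disc are represented by total functions; their values outside
  the disc are irrelevant.  The notion is only meant for \<open>f\<close> and \<open>g\<close> analytic on the disc.\<close>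

definition subordinate :: "(complex \<Rightarrow> complex) \<Rightarrow> (complex \<Rightarrow> complex) \<Rightarrow> bool"
    (infix "\<prec>\<^sub>s" 50) where
  "f \<prec>\<^sub>s g \<longleftrightarrow> (\<exists>w. w analytic_on unit_disc \<and> w ` unit_disc \<subseteq> unit_disc \<and> w 0 = 0 \<and>
     (\<forall>z\<in>unit_disc. f z = g (w z)))"

end

theory Submission
  imports Defs
begin

text \<open>Put \<open>w = p\<^sup>2 - 1\<close>.  If \<open>|w| < 1\<close> on the whole disc, then \<open>Re p > 0\<close> by connectedness and
  \<open>p = csqrt (1 + w)\<close>.  Otherwise take a point \<open>z0\<close> of least modulus with \<open>|w z0| = 1\<close> and write
  \<open>w (z0 * exp s) = w z0 * exp (h s)\<close> near \<open>s = 0\<close>.  As \<open>Re h\<close> restricted to the imaginary axis has a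
  maximum at \<open>0\<close> and \<open>w z = O(z\<^sup>2)\<close>, the number \<open>h' 0\<close> is real and at least \<open>2\<close>, and \<open>Re (h'' 0) \<ge> 0\<close>.
  Since \<open>z p' + z\<^sup>2 p''\<close> is the second derivative of \<open>p (z0 * exp s)\<close>, this forces
  \<open>|p\<^sup>2 + z p' + z\<^sup>2 p'' - 1| \<ge> 1 + 3 / (2 * sqrt 2)\<close> at \<open>z0\<close>, against the subordination.\<close>

section \<open>The algebraic estimate at a boundary point\<close>

text \<open>The Moebius map t / (1 + t) takes the unit circle without -1 to a vertical line.\<close>

lemma Re_divide_one_plus_unit:
  assumes "norm w = 1" "1 + w \<noteq> 0"
  shows "Re (w / (1 + w)) = 1 / 2"
proof -
  have n: "(Re w)\<^sup>2 + (Im w)\<^sup>2 = 1"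
    using assms(1) by (simp add: cmod_def)
  have "(1 + Re w)\<^sup>2 + (Im w)\<^sup>2 \<noteq> 0"
    using assms(2) by (metis cmod_power2 norm_eq_zero one_complex.sel plus_complex.sel power_eq_0_iff add_0)
  moreover have "(1 + Re w)\<^sup>2 + (Im w)\<^sup>2 = 2 * (1 + Re w)"
    using n by (simp add: power2_sum)
  moreover have "Re w * (1 + Re w) + Im w * Im w = 1 + Re w"
    using n by (simp add: algebra_simps power2_eq_square)
  ultimately show ?thesis
    by (simp add: Re_divide)
qed

text \<open>Here \<open>a\<close> and \<open>b\<close> stand for \<open>h' 0\<close> and \<open>h'' 0\<close>, and \<open>P1\<close>, \<open>P2\<close> for the first two derivatives of
  \<open>p (z0 * exp s)\<close> at \<open>s = 0\<close>.\<close>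

lemma second_order_lower_bound:
  fixes w P P1 P2 a b :: complex
  assumes w: "norm w = 1" and P: "P\<^sup>2 = 1 + w" and ReP: "Re P \<ge> 0"
    and e1: "2 * P * P1 = a * w" and e2: "2 * P1\<^sup>2 + 2 * P * P2 = (b + a\<^sup>2) * w"
    and a: "Im a = 0" "Re a \<ge> 2" and b: "Re b \<ge> 0"
  shows "norm (w + P2) \<ge> 1 + 3 / (2 * sqrt 2)"
proof -
  have w0: "w \<noteq> 0" using w by auto
  have P0: "P \<noteq> 0"
    using e1 w0 a by auto
  define \<rho> where "\<rho> = norm P"
  have \<rho>0: "\<rho> > 0" using P0 by (simp add: \<rho>_def)
  \<comment> \<open>Eliminating \<open>P1\<close> from \<open>e2\<close> by \<open>e1\<close> and
    P^2 = 1 + w gives \<open>2 * P * P2 = L * w\<close>. The quotient w / (1 + w) costs a quarter of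
    a^2 in the real part, so Re L >= (3/4) * 4.\<close>
  define L where "L = b + a\<^sup>2 - a\<^sup>2 * (w / (1 + w)) / 2"
  have "1 + w \<noteq> 0" using P P0 by (metis power_eq_0_iff)
  then have R: "Re (w / (1 + w)) = 1 / 2"
    by (rule Re_divide_one_plus_unit[OF w])
  have ar: "a = of_real (Re a)" using a by (simp add: complex_eq_iff)
  have "Re L = Re b + 3 / 4 * (Re a)\<^sup>2"
  proof -
    have "a\<^sup>2 = of_real ((Re a)\<^sup>2)" by (subst ar) simp
    then have "L = b + of_real ((Re a)\<^sup>2) - of_real ((Re a)\<^sup>2 / 2) * (w / (1 + w))"
      by (simp add: L_def)
    moreover have "Re (b + of_real x - of_real (x / 2) * t) = Re b + x - x / 2 * Re t" for x t
      by simp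
    ultimately show ?thesis by (simp only: R)
  qed
  moreover have "(Re a)\<^sup>2 \<ge> 4"
    using power_mono[OF a(2), of 2] by simp
  ultimately have L: "Re L \<ge> 3" using b by simp
  have P1: "P1 = a * w / (2 * P)" using e1 P0 by (simp add: field_simps)
  \<comment> \<open>Multiplying by P clears the denominator of P2; then |w| = 1 removes w from the
    modulus.\<close>
  have "(w + P2) * P = w * (P + L / 2)"
  proof -
    have "2 * P * P2 = (b + a\<^sup>2) * w - 2 * (a * w / (2 * P))\<^sup>2"
      using e2 P1 by (simp add: algebra_simps)
    also have "2 * (a * w / (2 * P))\<^sup>2 = a\<^sup>2 * (w / (1 + w)) / 2 * w"
      unfolding P[symmetric] using P0 by (simp add: field_simps power2_eq_square)
    finally have "2 * P * P2 = L * w" by (simp add: L_def algebra_simps)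
    then show ?thesis by (simp add: algebra_simps)
  qed
  then have "norm (w + P2) * \<rho> = norm (P + L / 2)"
    using w unfolding \<rho>_def by (metis norm_mult mult_1)
  also have "\<dots> \<ge> Re (P + L / 2)" by (rule complex_Re_le_cmod)
  finally have main: "norm (w + P2) * \<rho> \<ge> Re P + 3 / 2" using L by simp
  have n: "(Re w)\<^sup>2 + (Im w)\<^sup>2 = 1"
    using w by (simp add: cmod_def)
  have "\<rho>\<^sup>2 = norm (1 + w)" unfolding \<rho>_def by (metis P norm_power)
  then have r4: "(\<rho>\<^sup>2)\<^sup>2 = 2 + 2 * Re w"
    using n by (simp add: cmod_power2 power2_sum)
  have r2: "\<rho>\<^sup>2 = (Re P)\<^sup>2 + (Im P)\<^sup>2" by (simp add: \<rho>_def cmod_power2)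
  have "(Re P)\<^sup>2 - (Im P)\<^sup>2 = 1 + Re w"
    using arg_cong[OF P, of Re] by (simp add: power2_eq_square)
  then have c2: "4 * (Re P)\<^sup>2 = \<rho>\<^sup>2 * (2 + \<rho>\<^sup>2)"
    using r4 r2 by (simp add: distrib_left flip: power2_eq_square)
  have "Re w \<le> 1" using complex_Re_le_cmod[of w] w by simp
  then have "(\<rho>\<^sup>2)\<^sup>2 \<le> 2\<^sup>2" using r4 by simp
  then have \<rho>2: "\<rho>\<^sup>2 \<le> 2" by (rule power2_le_imp_le) simp
  then have \<rho>s: "\<rho> \<le> sqrt 2" by (rule real_le_rsqrt)
  \<comment> \<open>Replacing one factor Re P in \<open>c2\<close> by \<rho> gives a lower bound
    that is linear in Re P, with equality when P > 0.\<close>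
  have "Re P \<le> \<rho>" by (simp add: \<rho>_def complex_Re_le_cmod)
  then have "4 * (Re P)\<^sup>2 \<le> 4 * (Re P * \<rho>)"
    using ReP by (simp add: power2_eq_square mult_left_mono)
  then have "\<rho> * (\<rho> * (2 + \<rho>\<^sup>2)) \<le> \<rho> * (4 * Re P)"
    using c2 by (simp add: power2_eq_square algebra_simps)
  then have RP: "\<rho> * (2 + \<rho>\<^sup>2) \<le> 4 * Re P" using \<rho>0 by simp
  have s2: "sqrt 2 * sqrt 2 = 2" by simp
  have s3: "4 / 3 \<le> sqrt 2" by (rule real_le_rsqrt) (simp add: power2_eq_square)
  have "1 + 3 / (2 * sqrt 2) = 1 + 3 * sqrt 2 / 4"
    using s2 by (simp add: field_simps)
  \<comment> \<open>Four times the difference of the two sides factors as below, with root \<rho> =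
    sqrt 2. This extremal case w = 1, P = sqrt 2 is where the constant comes from: (sqrt 2 + 3/2) /
    sqrt 2.\<close>
  moreover have "(1 + 3 * sqrt 2 / 4) * \<rho> \<le> \<rho> * (2 + \<rho>\<^sup>2) / 4 + 3 / 2"
  proof -
    have "\<rho> * (\<rho> + sqrt 2) \<le> sqrt 2 * (sqrt 2 + sqrt 2)"
      using \<rho>s \<rho>0 by (intro mult_mono) auto
    then have "\<rho> * (\<rho> + sqrt 2) \<le> 4" using s2 by (simp add: algebra_simps)
    moreover have "3 * sqrt 2 \<ge> 4" using s3 by simp
    ultimately have "0 \<le> (sqrt 2 - \<rho>) * (3 * sqrt 2 - \<rho> * (\<rho> + sqrt 2))"
      using \<rho>s by (intro mult_nonneg_nonneg) auto
    also have "\<dots> = 3 * (sqrt 2 * sqrt 2) - 3 * sqrt 2 * \<rho> - (sqrt 2 * sqrt 2) * \<rho> + \<rho> * \<rho> * \<rho>"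
      by (simp only: algebra_simps)
    finally show ?thesis by (simp add: s2 field_simps power2_eq_square)
  qed
  moreover have "\<rho> * (2 + \<rho>\<^sup>2) / 4 + 3 / 2 \<le> Re P + 3 / 2"
    using RP by simp
  ultimately have "(1 + 3 / (2 * sqrt 2)) * \<rho> \<le> norm (w + P2) * \<rho>"
    using main by (metis order_trans)
  then show ?thesis using \<rho>0 by simp
qed

section \<open>Derivative tests at a boundary maximum\<close>

text \<open>If D were positive, f' would be positive just to the right of 0, and the mean value
  theorem would push f above its maximum.\<close>

lemma local_max_second_deriv_nonpos:
  fixes f f' :: "real \<Rightarrow> real"
  assumes e: "e > 0" and f: "\<And>t. \<bar>t\<bar> < e \<Longrightarrow> (f has_real_derivative f' t) (at t)"
    and f': "(f' has_real_derivative D) (at 0)"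
    and max: "\<And>t. \<bar>t\<bar> < e \<Longrightarrow> f t \<le> f 0"
  shows "f' 0 = 0" "D \<le> 0"
proof -
  show z: "f' 0 = 0"
    by (rule DERIV_local_max[OF f e]) (use e max in auto)
  show "D \<le> 0"
  proof (rule ccontr)
    assume "\<not> D \<le> 0"
    then obtain d where d: "d > 0" "\<And>h. h > 0 \<Longrightarrow> h < d \<Longrightarrow> f' 0 < f' (0 + h)"
      using DERIV_pos_inc_right[OF f'] by force
    define t where "t = min d e / 2"
    have t: "0 < t" "t < d" "t < e" using d e by (auto simp: t_def)
    obtain s where s: "0 < s" "s < t" "f t - f 0 = (t - 0) * f' s"
      using MVT2[of 0 t f f'] f t by force
    have "f' s > 0" using d(2)[of s] s t z by simp
    then have "f t - f 0 > 0" using s t by simp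
    then show False using max[of t] t by simp
  qed
qed

lemma DERIV_scaled_arg:
  assumes "(f has_field_derivative D) (at (c * x))"
  shows "((\<lambda>z. f (c * z)) has_field_derivative c * D) (at x)"
  using DERIV_chain2[OF assms DERIV_cmult_Id] by (simp add: mult.commute)

text \<open>In exponential coordinates the imaginary axis is the circle through the maximum point
  and the negative real axis the inward radius. Along the former Re h has derivatives -Im h'(0) and
  -Re h''(0); decay along the latter bounds Re h'(0) from below.\<close>

lemma boundary_max_log_derivs:
  fixes h :: "complex \<Rightarrow> complex"
  assumes e: "e > 0" and h: "h holomorphic_on ball 0 e" and h0: "h 0 = 0"
    and im: "\<And>y. \<bar>y\<bar> < e \<Longrightarrow> Re (h (\<i> * of_real y)) \<le> 0"
    and re: "\<And>t. 0 < t \<Longrightarrow> t < e \<Longrightarrow> Re (h (- of_real t)) \<le> - (k * t)"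
  shows "Im (deriv h 0) = 0" "Re (deriv h 0) \<ge> k" "Re (deriv (deriv h) 0) \<ge> 0"
proof -
  have d1: "(h has_field_derivative deriv h z) (at z)" if "z \<in> ball 0 e" for z
    using h that holomorphic_derivI open_ball by blast
  have d2: "(deriv h has_field_derivative deriv (deriv h) 0) (at 0)"
    using holomorphic_derivI[OF holomorphic_deriv[OF h open_ball] open_ball] e by simp
  have f1: "((\<lambda>y. Re (h (\<i> * of_real y))) has_real_derivative Re (\<i> * deriv h (\<i> * of_real y))) (at y)"
    if "\<bar>y\<bar> < e" for y
  proof -
    have "(h has_field_derivative deriv h (\<i> * of_real y)) (at (\<i> * of_real y))"
      using that by (intro d1) (simp add: norm_mult)
    then have "((\<lambda>z. h (\<i> * z)) has_field_derivative \<i> * deriv h (\<i> * of_real y)) (at (of_real y))"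
      by (rule DERIV_scaled_arg)
    from has_field_derivative_Re[OF has_vector_derivative_real_field[OF this]]
    show ?thesis .
  qed
  have f2: "((\<lambda>y. Re (\<i> * deriv h (\<i> * of_real y))) has_real_derivative
      Re (\<i> * (\<i> * deriv (deriv h) 0))) (at 0)"
  proof -
    have "((\<lambda>z. \<i> * deriv h (\<i> * z)) has_field_derivative \<i> * (\<i> * deriv (deriv h) 0)) (at (of_real 0))"
      using d2 by (intro DERIV_cmult DERIV_scaled_arg) simp
    from has_field_derivative_Re[OF has_vector_derivative_real_field[OF this]]
    show ?thesis .
  qed
  have "Re (\<i> * deriv h (\<i> * of_real 0)) = 0" "Re (\<i> * (\<i> * deriv (deriv h) 0)) \<le> 0"
    using local_max_second_deriv_nonpos[OF e f1 f2] im h0 by simp_all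
  then show "Im (deriv h 0) = 0" "Re (deriv (deriv h) 0) \<ge> 0" by auto
  show "Re (deriv h 0) \<ge> k"
  proof (rule ccontr)
    assume neg: "\<not> Re (deriv h 0) \<ge> k"
    \<comment> \<open>With Re h'(0) < k, the function -Re h(-t) - k t would have negative slope at
      0, so it would be negative for small t > 0, against \<open>re\<close>.\<close>
    have "((\<lambda>z. - h (- z)) has_field_derivative deriv h 0) (at (of_real 0))"
      using DERIV_minus[OF DERIV_scaled_arg[of h "deriv h 0" "-1" 0]] d1[of 0] e by simp
    from has_field_derivative_Re[OF has_vector_derivative_real_field[OF this]]
    have "((\<lambda>t. Re (- h (- of_real t)) - k * t) has_real_derivative Re (deriv h 0) - k) (at 0)"
      by (rule DERIV_diff[OF _ DERIV_cmult_Id])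
    from DERIV_neg_dec_right[OF this] neg obtain d where
      d: "d > 0" "\<And>t. t > 0 \<Longrightarrow> t < d \<Longrightarrow> Re (- h (- of_real t)) - k * t < 0"
      using h0 by auto
    define t where "t = min d e / 2"
    have "0 < t" "t < d" "t < e" using d e by (auto simp: t_def)
    then show False using d(2)[of t] re[of t] by simp
  qed
qed

section \<open>Growth at a zero of order n and a second-order Jack lemma\<close>

text \<open>As in the Schwarz lemma, the maximum principle is applied to the cofactor v rather than
  to f.\<close>

lemma max_modulus_power_factor:
  assumes v: "v holomorphic_on ball 0 R" and r: "0 < r" "r < R"
    and f: "\<And>z. norm z \<le> r \<Longrightarrow> f z = z ^ n * v z"
    and bound: "\<And>z. norm z = r \<Longrightarrow> norm (f z) \<le> M"
    and z: "norm z \<le> r"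
  shows "norm (f z) \<le> M * (norm z / r) ^ n"
proof -
  have "norm (v z) \<le> M / r ^ n"
  proof (rule maximum_modulus_frontier[of v "cball 0 r"])
    show "v holomorphic_on interior (cball 0 r)"
      using r by (intro holomorphic_on_subset[OF v]) auto
    show "continuous_on (closure (cball 0 r)) v"
      using r by (intro holomorphic_on_imp_continuous_on holomorphic_on_subset[OF v]) auto
    show "norm (v y) \<le> M / r ^ n" if "y \<in> frontier (cball 0 r)" for y
    proof -
      have y: "norm y = r" using that r by (simp add: sphere_def)
      then have "r ^ n * norm (v y) \<le> M"
        using bound[OF y] f[of y] by (simp add: norm_mult norm_power)
      then show ?thesis using r by (simp add: field_simps)
    qed
  qed (use z in auto)
  then have "norm z ^ n * norm (v z) \<le> norm z ^ n * (M / r ^ n)"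
    by (rule mult_left_mono) simp
  then show ?thesis
    using f[OF z] by (simp add: norm_mult norm_power power_divide mult.commute)
qed

text \<open>The substitution z = z0 exp s turns z d/dz into d/ds, so a and b are the first two
  derivatives at 0 of the logarithm of w(z0 exp s) / w(z0).\<close>

lemma second_order_Jack:
  assumes w: "w holomorphic_on ball 0 R" and z0: "z0 \<in> ball 0 R"
    and w0: "w z0 \<noteq> 0"
    and bound: "\<And>z. norm z \<le> norm z0 \<Longrightarrow> norm (w z) \<le> norm (w z0) * (norm z / norm z0) ^ n"
  obtains a b where "Im a = 0" "Re a \<ge> real n" "Re b \<ge> 0"
    "z0 * deriv w z0 = a * w z0"
    "z0 * deriv w z0 + z0\<^sup>2 * deriv (deriv w) z0 = (b + a\<^sup>2) * w z0"
proof -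
  \<comment> \<open>T is a neighbourhood of z0 on which the quotient, equal to 1 at z0, stays off
    the branch cut of \<open>Ln\<close>.\<close>
  define T where "T = {z \<in> ball 0 R. w z / w z0 \<in> - \<real>\<^sub>\<le>\<^sub>0}"
  define E where "E = (\<lambda>s. z0 * exp s)"
  have "continuous_on (ball 0 R) (\<lambda>z. w z / w z0)"
    using w w0 by (intro continuous_intros holomorphic_on_imp_continuous_on) auto
  then have "open T" unfolding T_def Collect_conj_eq
    using continuous_open_preimage[of "ball 0 R" "\<lambda>z. w z / w z0" "- \<real>\<^sub>\<le>\<^sub>0"]
    by (simp add: vimage_def Int_def open_Compl)
  then have "open (E -` T)" unfolding E_def
    by (intro open_vimage continuous_intros)
  moreover have "0 \<in> E -` T" using z0 w0 by (simp add: E_def T_def)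
  ultimately obtain e where e: "e > 0" "ball 0 e \<subseteq> E -` T"
    by (meson openE)
  have ET: "E s \<in> ball 0 R" "w (E s) / w z0 \<notin> \<real>\<^sub>\<le>\<^sub>0" "w (E s) \<noteq> 0" if "s \<in> ball 0 e" for s
    using e(2) that by (auto simp: T_def)
  define h where "h = (\<lambda>s. Ln (w (E s) / w z0))"
  define g where "g = (\<lambda>s. E s * deriv w (E s) / w (E s))"
  have dE: "(E has_field_derivative E s) (at s)" for s
    unfolding E_def by (auto intro!: derivative_eq_intros)
  have dw: "((\<lambda>s. w (E s)) has_field_derivative deriv w (E s) * E s) (at s)" if "s \<in> ball 0 e" for s
    by (rule DERIV_chain2[OF holomorphic_derivI[OF w open_ball ET(1)[OF that]] dE])
  have dw2: "((\<lambda>s. deriv w (E s)) has_field_derivative deriv (deriv w) (E s) * E s) (at s)"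
    if "s \<in> ball 0 e" for s
    by (rule DERIV_chain2[OF holomorphic_derivI[OF holomorphic_deriv[OF w open_ball] open_ball ET(1)[OF that]] dE])
  have dh: "(h has_field_derivative g s) (at s)" if "s \<in> ball 0 e" for s
  proof -
    have "(h has_field_derivative inverse (w (E s) / w z0) * (deriv w (E s) * E s / w z0)) (at s)"
      unfolding h_def
      by (rule DERIV_chain2[OF has_field_derivative_Ln[OF ET(2)[OF that]] DERIV_cdivide[OF dw[OF that]]])
    then show ?thesis using w0 ET(3)[OF that] by (simp add: g_def field_simps)
  qed
  have hol: "h holomorphic_on ball 0 e"
    using dh by (metis holomorphic_on_open open_ball)
  have E0: "E 0 = z0" by (simp add: E_def)
  \<comment> \<open>Since |E s| / |z0| = exp (Re s), taking logarithms makes \<open>bound\<close>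
    linear in Re s; it yields both \<open>im\<close> and \<open>re\<close> below.\<close>
  have Re_h: "Re (h s) \<le> n * Re s" if "s \<in> ball 0 e" "Re s \<le> 0" for s
  proof -
    have "norm (w (E s)) \<le> norm (w z0) * (norm (E s) / norm z0) ^ n"
      using that by (intro bound) (simp add: E_def norm_mult mult_left_le)
    also have "\<dots> \<le> norm (w z0) * exp (Re s) ^ n"
      by (intro mult_left_mono power_mono) (auto simp: E_def norm_mult)
    finally have "norm (w (E s) / w z0) \<le> exp (n * Re s)"
      using w0 by (simp add: norm_divide field_simps flip: exp_of_nat2_mult)
    then have "ln (norm (w (E s) / w z0)) \<le> n * Re s"
      using ET(3)[OF that(1)] w0 ln_le_cancel_iff[of "norm (w (E s) / w z0)" "exp (n * Re s)"] by simp
    then show ?thesis using ET(3)[OF that(1)] w0 by (simp add: h_def)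
  qed
  have h0: "h 0 = 0" using w0 E0 by (simp add: h_def)
  have im: "Re (h (\<i> * of_real y)) \<le> 0" if "\<bar>y\<bar> < e" for y
    using Re_h[of "\<i> * of_real y"] that by (simp add: norm_mult)
  have re: "Re (h (- of_real t)) \<le> - (real n * t)" if "0 < t" "t < e" for t
    using Re_h[of "- of_real t"] that by simp
  note 1 = boundary_max_log_derivs[OF e(1) hol h0 im re]
  have h1: "deriv h 0 = z0 * deriv w z0 / w z0"
    using DERIV_imp_deriv[OF dh[of 0]] e(1) by (simp add: g_def E0)
  \<comment> \<open>The derivative of h is g near 0, so h'' follows from the quotient rule for z w'
    / w.\<close>
  have "deriv (deriv h) 0 = deriv g 0"
    using e(1) by (intro deriv_cong_ev eventually_nhds_in_open[THEN eventually_mono, of "ball 0 e"])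
      (auto intro!: DERIV_imp_deriv dh)
  also have "(g has_field_derivative
      ((E 0 * deriv w (E 0) + (deriv (deriv w) (E 0) * E 0) * E 0) * w (E 0) -
       (E 0 * deriv w (E 0)) * (deriv w (E 0) * E 0)) / (w (E 0) * w (E 0))) (at 0)"
    unfolding g_def using e(1) ET(3)[of 0] DERIV_mult[OF dE dw2[of 0]]
    by (intro DERIV_divide dw) (simp_all add: add.commute)
  then have "deriv g 0 = (z0 * deriv w z0 + z0\<^sup>2 * deriv (deriv w) z0) / w z0 - (deriv h 0)\<^sup>2"
    unfolding h1 E0 using w0 by (subst DERIV_imp_deriv) (auto simp: field_simps power2_eq_square)
  finally have h2: "deriv (deriv h) 0 = \<dots>" .
  show ?thesis
    by (rule that[OF 1]) (use h1 h2 w0 in \<open>simp_all add: field_simps\<close>)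
qed

section \<open>Exit point, choice of the root, and the Taylor factor\<close>

text \<open>Points of the closed disc through a with |w| >= M form a compact set, so one has least
  modulus. Continuity carries |w| <= M from the open disc to its boundary circle, forcing equality
  at z0.\<close>

lemma first_exit_point:
  fixes w :: "complex \<Rightarrow> complex"
  assumes w: "continuous_on (ball 0 R) w" and w0: "norm (w 0) < M"
    and a: "a \<in> ball 0 R" "norm (w a) \<ge> M"
  obtains z0 where "z0 \<in> ball 0 R" "z0 \<noteq> 0" "norm (w z0) = M"
    "\<And>z. norm z < norm z0 \<Longrightarrow> norm (w z) < M"
    "\<And>z. norm z \<le> norm z0 \<Longrightarrow> norm (w z) \<le> M"
proof -
  have sub: "cball 0 (norm a) \<subseteq> ball 0 R" using a by auto
  define K where "K = {z \<in> cball 0 (norm a). norm (w z) \<in> {M..}}"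
  have "closed K" unfolding K_def Collect_conj_eq
    using continuous_closed_preimage[of "cball 0 (norm a)" "\<lambda>z. norm (w z)" "{M..}"]
      continuous_on_norm[OF continuous_on_subset[OF w sub]]
    by (simp add: vimage_def Int_def)
  moreover have "K \<subseteq> cball 0 (norm a)" by (auto simp: K_def)
  ultimately have "compact K" unfolding compact_eq_bounded_closed
    using bounded_subset bounded_cball by blast
  moreover have "a \<in> K" using a by (simp add: K_def)
  ultimately obtain z0 where z0: "z0 \<in> K" "\<And>z. z \<in> K \<Longrightarrow> norm z0 \<le> norm z"
    using continuous_attains_inf[of K norm] continuous_on_norm_id by blast
  have z0': "z0 \<in> ball 0 R" "norm (w z0) \<ge> M" "norm z0 \<le> norm a" using z0(1) a by (auto simp: K_def)
  have lt: "norm (w z) < M" if "norm z < norm z0" for z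
    using z0(2)[of z] z0'(3) that by (force simp: K_def)
  \<comment> \<open>Only for a positive radius is the closure of the open ball the closed disc, as
    \<open>le\<close> requires.\<close>
  have nz: "z0 \<noteq> 0" using z0'(2) w0 by auto
  have le: "norm (w z) \<le> M" if "norm z \<le> norm z0" for z
  proof (rule continuous_le_on_closure[of "ball 0 (norm z0)" "\<lambda>z. norm (w z)"])
    show "continuous_on (closure (ball 0 (norm z0))) (\<lambda>z. norm (w z))"
      using z0' nz by (intro continuous_on_norm continuous_on_subset[OF w]) auto
  qed (use that nz lt in \<open>auto intro: less_imp_le\<close>)
  show ?thesis
    using that[OF z0'(1) nz _ lt le] z0'(2) le[of z0] by auto
qed

text \<open>A purely imaginary value has square <= 0, at distance at least 1 from 1. So Re p never
  vanishes, and by connectedness it keeps its sign at 0.\<close>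

lemma Re_pos_of_square_near_1:
  fixes p :: "complex \<Rightarrow> complex"
  assumes p: "continuous_on (ball 0 r) p" and p0: "p 0 = 1"
    and near: "\<And>z. z \<in> ball 0 r \<Longrightarrow> norm ((p z)\<^sup>2 - 1) < 1"
    and z: "z \<in> ball 0 r"
  shows "Re (p z) > 0"
proof (rule ccontr)
  assume neg: "\<not> Re (p z) > 0"
  have "connected ((\<lambda>z. Re (p z)) ` ball 0 r)"
    using p by (intro connected_continuous_image continuous_intros) auto
  moreover have "Re (p z) \<in> (\<lambda>z. Re (p z)) ` ball 0 r" using z by blast
  moreover have "0 \<in> ball (0::complex) r" using z by (auto intro: le_less_trans[OF norm_ge_zero])
  then have "1 \<in> (\<lambda>z. Re (p z)) ` ball 0 r" by (rule rev_image_eqI) (simp add: p0)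
  ultimately have "0 \<in> (\<lambda>z. Re (p z)) ` ball 0 r"
    using neg by (auto intro: connectedD_interval)
  then obtain y where y: "y \<in> ball 0 r" "Re (p y) = 0" by auto
  then have "Re ((p y)\<^sup>2 - 1) \<le> - 1" by (simp add: power2_eq_square)
  then have "norm ((p y)\<^sup>2 - 1) \<ge> 1" using abs_Re_le_cmod[of "(p y)\<^sup>2 - 1"] by linarith
  then show False using near[OF y(1)] by simp
qed

lemma H_class_factor:
  assumes "f \<in> H_class a n"
  obtains u where "u holomorphic_on unit_disc" "\<And>z. z \<in> unit_disc \<Longrightarrow> f z = a + z ^ n * u z"
proof -
  obtain c where c: "\<And>z. z \<in> unit_disc \<Longrightarrow> (\<lambda>k. c k * z ^ (k + n)) sums (f z - a)"
    using assms unfolding H_class_def by blast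
  \<comment> \<open>The value at 0 is the constant term of the shifted series, which makes u its sum
    on the whole disc.\<close>
  define u where "u = (\<lambda>z. if z = 0 then c 0 else (f z - a) / z ^ n)"
  have "(\<lambda>k. c k * (z - 0) ^ k) sums u z" if "z \<in> unit_disc" for z
  proof (cases "z = 0")
    case True
    then show ?thesis using powser_sums_zero[of c] by (simp add: u_def)
  next
    case False
    then show ?thesis using sums_divide[OF c[OF that], of "z ^ n"] by (simp add: u_def power_add)
  qed
  then have "u holomorphic_on unit_disc" by (rule power_series_holomorphic)
  moreover have "f z = a + z ^ n * u z" if "z \<in> unit_disc" for z
  proof (cases "z = 0")
    case True
    \<comment> \<open>With 0^0 = 1 this treats n = 0 and n > 0 together.\<close>
    have "(\<lambda>k. c k * 0 ^ (k + n)) sums (c 0 * 0 ^ n)"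
      using powser_sums_zero[of "\<lambda>k. c k * 0 ^ n"] by (simp add: power_add mult_ac)
    from sums_unique2[OF this, of "f 0 - a"] show ?thesis
      using c[of 0] True by (simp add: u_def algebra_simps)
  qed (simp add: u_def)
  ultimately show ?thesis by (rule that)
qed

section \<open>The subordination\<close>

theorem lemma4p3:
  fixes p :: "complex \<Rightarrow> complex"
  assumes "p analytic_on unit_disc"
    and "p 0 = 1"
    and "p \<in> H_class 1 2"
    and "(\<lambda>z. (p z)\<^sup>2 + z * deriv p z + z\<^sup>2 * deriv (deriv p) z)
           \<prec>\<^sub>s (\<lambda>z. 1 + of_real (1 + 3 / (2 * sqrt 2)) * z)"
  shows "p \<prec>\<^sub>s (\<lambda>z. csqrt (1 + z))"
proof -
  define w where "w = (\<lambda>z. (p z)\<^sup>2 - 1)"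
  have ph: "p holomorphic_on unit_disc"
    using assms(1) by (simp add: analytic_on_open)
  have pc: "continuous_on unit_disc p" by (rule holomorphic_on_imp_continuous_on[OF ph])
  have wh: "w holomorphic_on unit_disc" unfolding w_def by (intro holomorphic_intros ph)
  have w00: "w 0 = 0" using assms(2) by (simp add: w_def)
  have less: "norm (w z) < 1" if z: "z \<in> unit_disc" for z
  proof (rule ccontr)
    assume "\<not> norm (w z) < 1"
    then obtain z0 where z0: "z0 \<in> unit_disc" "z0 \<noteq> 0" "norm (w z0) = 1"
      and lt: "\<And>z. norm z < norm z0 \<Longrightarrow> norm (w z) < 1"
      and le: "\<And>z. norm z \<le> norm z0 \<Longrightarrow> norm (w z) \<le> 1"
      using first_exit_point[OF holomorphic_on_imp_continuous_on[OF wh], of 1 z] z w00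
      by (metis norm_zero not_le zero_less_one)
    \<comment> \<open>Strict positivity holds inside the circle through z0, where |w| < 1; the limit
      at z0 keeps only the weak inequality.\<close>
    have "0 \<le> Re (p z0)"
    proof (rule continuous_ge_on_closure[of "ball 0 (norm z0)" "\<lambda>z. Re (p z)"])
      show "continuous_on (closure (ball 0 (norm z0))) (\<lambda>z. Re (p z))"
        using z0 by (intro continuous_on_Re continuous_on_subset[OF pc]) auto
      show "0 \<le> Re (p z)" if "z \<in> ball 0 (norm z0)" for z
        using z0 lt that assms(2)
        by (intro less_imp_le Re_pos_of_square_near_1[of "norm z0"] continuous_on_subset[OF pc])
          (auto simp: w_def)
    qed (use z0 in auto)
    obtain u where u: "u holomorphic_on unit_disc" "\<And>z. z \<in> unit_disc \<Longrightarrow> p z = 1 + z\<^sup>2 * u z"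
      using H_class_factor[OF assms(3)] by metis
    \<comment> \<open>Because w = (p - 1) (p + 1) and p - 1 = z^2 u, the order of vanishing is n =
      2.\<close>
    have "norm (w z) \<le> norm (w z0) * (norm z / norm z0)\<^sup>2" if "norm z \<le> norm z0" for z
      unfolding z0(3)
    proof (rule max_modulus_power_factor)
      show "(\<lambda>z. u z * (p z + 1)) holomorphic_on unit_disc"
        by (intro holomorphic_intros u ph)
      show "w z = z\<^sup>2 * (u z * (p z + 1))" if "norm z \<le> norm z0" for z
        using u(2)[of z] that z0 by (simp add: w_def power2_eq_square algebra_simps)
    qed (use z0 le that in auto)
    then obtain a b where ab: "Im a = 0" "Re a \<ge> 2" "Re b \<ge> 0"
      "z0 * deriv w z0 = a * w z0"
      "z0 * deriv w z0 + z0\<^sup>2 * deriv (deriv w) z0 = (b + a\<^sup>2) * w z0"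
      using second_order_Jack[OF wh z0(1), of 2] z0(3) by force
    have dp: "(p has_field_derivative deriv p z) (at z)"
      "(deriv p has_field_derivative deriv (deriv p) z) (at z)" if "z \<in> unit_disc" for z
      using that by (auto intro: holomorphic_derivI[OF ph] holomorphic_derivI[OF holomorphic_deriv[OF ph]])
    have w1: "deriv w z = 2 * p z * deriv p z" if "z \<in> unit_disc" for z
      unfolding w_def using dp(1)[OF that]
      by (intro DERIV_imp_deriv) (auto intro!: derivative_eq_intros)
    have "deriv (deriv w) z0 = deriv (\<lambda>z. 2 * p z * deriv p z) z0"
      by (intro deriv_cong_ev eventually_nhds_in_open[THEN eventually_mono, of unit_disc])
        (use z0(1) w1 in auto)
    also have "\<dots> = 2 * (deriv p z0)\<^sup>2 + 2 * p z0 * deriv (deriv p) z0"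
      using dp[OF z0(1)] by (intro DERIV_imp_deriv)
        (auto intro!: derivative_eq_intros simp: power2_eq_square algebra_simps)
    finally have w2: "deriv (deriv w) z0 = \<dots>" .
    have "norm (w z0 + (z0 * deriv p z0 + z0\<^sup>2 * deriv (deriv p) z0)) \<ge> 1 + 3 / (2 * sqrt 2)"
    proof (rule second_order_lower_bound[OF z0(3) _ \<open>0 \<le> Re (p z0)\<close> _ _ ab(1-3)])
      show "(p z0)\<^sup>2 = 1 + w z0" by (simp add: w_def)
      show "2 * p z0 * (z0 * deriv p z0) = a * w z0"
        using ab(4) w1[OF z0(1)] by (simp add: algebra_simps)
      show "2 * (z0 * deriv p z0)\<^sup>2 + 2 * p z0 * (z0 * deriv p z0 + z0\<^sup>2 * deriv (deriv p) z0)
          = (b + a\<^sup>2) * w z0"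
        unfolding ab(5)[symmetric] w1[OF z0(1)] w2 by (simp add: algebra_simps power2_eq_square)
    qed
    moreover obtain \<omega> where \<omega>: "\<omega> ` unit_disc \<subseteq> unit_disc"
      "\<forall>z\<in>unit_disc. (p z)\<^sup>2 + z * deriv p z + z\<^sup>2 * deriv (deriv p) z
         = 1 + of_real (1 + 3 / (2 * sqrt 2)) * \<omega> z"
      using assms(4) unfolding subordinate_def by blast
    \<comment> \<open>The left side is the subordinated expression minus 1, so its modulus is the
      constant times |\<omega> z0| < 1, below the bound just shown.\<close>
    have "w z0 + (z0 * deriv p z0 + z0\<^sup>2 * deriv (deriv p) z0) = of_real (1 + 3 / (2 * sqrt 2)) * \<omega> z0"
      using bspec[OF \<omega>(2) z0(1)] by (simp add: w_def algebra_simps)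
    then have "norm (w z0 + (z0 * deriv p z0 + z0\<^sup>2 * deriv (deriv p) z0))
        = (1 + 3 / (2 * sqrt 2)) * norm (\<omega> z0)"
      by (simp only: norm_mult norm_of_real) simp
    moreover have "norm (\<omega> z0) < 1" using \<omega>(1) z0(1) by (auto simp: image_subset_iff)
    ultimately show False
      by (smt (verit) mult_less_cancel_left2 divide_nonneg_nonneg real_sqrt_ge_zero)
  qed
  \<comment> \<open>Positive real part singles out the principal root, so w itself is the Schwarz
    function.\<close>
  have "p z = csqrt (1 + w z)" if "z \<in> unit_disc" for z
    using Re_pos_of_square_near_1[OF pc assms(2) _ that] less
    by (intro csqrt_unique[symmetric]) (auto simp: w_def)
  then show ?thesis
    unfolding subordinate_def using wh w00 less
    by (intro exI[of _ w]) (auto simp: analytic_on_open)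
qed

end
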